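(* Let $\mathcal{L}\subset\mathbb{S}^n$ be an $m$-dimensional linear subspace that contains an invertible matrix, and let $U\in\mathcal{L}_{\rm inv}$. The following are equivalent: (a) The reciprocal variety $\mathcal{L}^{-1}$ is also a linear subspace of $\mathbb{S}^n$. (b) $\mathcal{L}$ is a subalgebra of the Jordan algebra $(\mathbb{S}^n,\bullet_U)$. (c) $\mathcal{L}^{-1}$ equals $\mathcal{L}$ up to congruence; namely $\mathcal{L}^{-1}=U^{-1}\mathcal{L}U^{-1}$.
   Context: $\mathbb{S}^n$ is the space of symmetric $n\times n$ matrices over $\mathbb{C}$. For a linear subspace $\mathcal{L}\subset\mathbb{S}^n$, $\mathcal{L}_{\rm inv}=\{X\in\mathcal{L}\mid\det(X)\neq0\}$. When $\mathcal{L}_{\rm inv}\neq\emptyset$, the reciprocal variety $\mathcal{L}^{-1}$ is the (Zariski) closure in $\mathbb{S}^n$ of $\{X^{-1}\mid X\in\mathcal{L}_{\rm inv}\}$. For an invertible $U\in\mathbb{S}^n$, the algebra $(\mathbb{S}^n,\bullet_U)$ is the vector space $\mathbb{S}^n$ with product $X\bullet_U Y=\frac12(XU^{-1}Y+YU^{-1}X)$; it is commutative with unit $U$. A subalgebra is a linear subspace closed under $\bullet_U$. *)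

theory Defs
  imports "HOL-Analysis.Analysis"
begin

text \<open>
  \<^typ>\<open>complex ^ 'n ^ 'n\<close> carries only the real scalar multiplication in the library, so
  the complex vector space structure on matrices is set up here.
\<close>

definition cmat_scale :: "complex \<Rightarrow> complex ^ 'n ^ 'm \<Rightarrow> complex ^ 'n ^ 'm" where
  "cmat_scale c A = (\<chi> i j. c * A $ i $ j)"

global_interpretation cmat: vector_space "cmat_scale :: complex \<Rightarrow> complex ^ 'n ^ 'm \<Rightarrow> _"
  defines cmat_subspace = cmat.subspace
    and cmat_dim = cmat.dim
  by unfold_locales (simp_all add: cmat_scale_def vec_eq_iff algebra_simps)

definition symmetric_matrices :: "(complex ^ 'n ^ 'n) set" where
  "symmetric_matrices = {X. transpose X = X}"

definition linear_subspace_of_symmetric :: "(complex ^ 'n ^ 'n) set \<Rightarrow> bool" where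
  "linear_subspace_of_symmetric L \<longleftrightarrow> cmat_subspace L \<and> L \<subseteq> symmetric_matrices"

definition invertible_part :: "(complex ^ 'n ^ 'n) set \<Rightarrow> (complex ^ 'n ^ 'n) set" where
  "invertible_part L = {X \<in> L. det X \<noteq> 0}"

text \<open>
  Every polynomial function on the space of symmetric matrices is the restriction of a polynomial
  in all the matrix entries.
\<close>

inductive matrix_polynomial_function :: "(complex ^ 'n ^ 'n \<Rightarrow> complex) \<Rightarrow> bool" where
  const: "matrix_polynomial_function (\<lambda>X. c)"
| entry: "matrix_polynomial_function (\<lambda>X. X $ i $ j)"
| add: "matrix_polynomial_function f \<Longrightarrow> matrix_polynomial_function g \<Longrightarrow>
    matrix_polynomial_function (\<lambda>X. f X + g X)"
| mult: "matrix_polynomial_function f \<Longrightarrow> matrix_polynomial_function g \<Longrightarrow>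
    matrix_polynomial_function (\<lambda>X. f X * g X)"

definition zariski_closed :: "(complex ^ 'n ^ 'n) set \<Rightarrow> bool" where
  "zariski_closed Z \<longleftrightarrow> (\<exists>F. (\<forall>f\<in>F. matrix_polynomial_function f) \<and>
     Z = {X \<in> symmetric_matrices. \<forall>f\<in>F. f X = 0})"

definition zariski_closure :: "(complex ^ 'n ^ 'n) set \<Rightarrow> (complex ^ 'n ^ 'n) set" where
  "zariski_closure S = zariski_closed hull S"

lemma zariski_closed_closure:
  assumes "S \<subseteq> symmetric_matrices"
  shows "zariski_closed (zariski_closure S)"
proof -
  let ?F = "{f. matrix_polynomial_function f \<and> (\<forall>X\<in>S. f X = 0)}"
  let ?Z = "{X \<in> symmetric_matrices. \<forall>f\<in>?F. f X = 0}"
  have closed: "zariski_closed ?Z"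
    unfolding zariski_closed_def by (intro exI[of _ ?F] conjI) auto
  moreover have "S \<subseteq> ?Z"
    using assms by auto
  ultimately have "zariski_closure S \<subseteq> ?Z"
    unfolding zariski_closure_def by (simp add: hull_minimal)
  moreover have "?Z \<subseteq> Z'" if Z': "zariski_closed Z'" "S \<subseteq> Z'" for Z'
  proof -
    obtain F where F: "\<forall>f\<in>F. matrix_polynomial_function f"
      and Z'_eq: "Z' = {X \<in> symmetric_matrices. \<forall>f\<in>F. f X = 0}"
      using Z'(1) unfolding zariski_closed_def by (elim exE conjE)
    have "F \<subseteq> ?F"
      using F Z'(2) Z'_eq by auto
    thus ?thesis
      unfolding Z'_eq by auto
  qed
  hence "?Z \<subseteq> zariski_closure S"
    unfolding zariski_closure_def hull_def by (intro Inter_greatest) simp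
  ultimately show ?thesis
    using closed by simp
qed

definition reciprocal_variety :: "(complex ^ 'n ^ 'n) set \<Rightarrow> (complex ^ 'n ^ 'n) set" where
  "reciprocal_variety L = zariski_closure (matrix_inv ` invertible_part L)"

definition jordan_product ::
  "complex ^ 'n ^ 'n \<Rightarrow> complex ^ 'n ^ 'n \<Rightarrow> complex ^ 'n ^ 'n \<Rightarrow> complex ^ 'n ^ 'n" where
  "jordan_product U X Y =
     cmat_scale (1 / 2) (X ** matrix_inv U ** Y + Y ** matrix_inv U ** X)"

definition jordan_subalgebra :: "complex ^ 'n ^ 'n \<Rightarrow> (complex ^ 'n ^ 'n) set \<Rightarrow> bool" where
  "jordan_subalgebra U L \<longleftrightarrow> linear_subspace_of_symmetric L \<and>
     (\<forall>X\<in>L. \<forall>Y\<in>L. jordan_product U X Y \<in> L)"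

end

theory Submission
  imports Defs
begin

text \<open>
  Write \<open>V\<close> for the inverse of \<open>U\<close> and \<open>M\<close> for the reciprocal variety of \<open>L\<close>. The only
  implications with content are from (a) to (b) and from (b) to (c), since \<open>V L V\<close> is visibly a
  linear subspace of symmetric matrices.

  Suppose that \<open>M\<close> is linear. Differentiating \<open>t \<mapsto> (U + t X)\<^sup>-\<^sup>1\<close> once and twice at \<open>t = 0\<close>, for
  \<open>X \<in> L\<close>, gives the elements \<open>V X V\<close> and \<open>V X V X V\<close> of \<open>M\<close>
  (\<open>resolvent_terms_in_subspace\<close>). The situation is symmetric in \<open>L\<close> and \<open>M\<close>: being inverse to an
  element of \<open>L\<close> is a closed condition once it is phrased with the adjugate, so inverses of
  invertible elements of \<open>M\<close> lie in \<open>L\<close> (\<open>adjugate_of_reciprocal_variety\<close>). Hence also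
  \<open>U Y U \<in> L\<close> for \<open>Y \<in> M\<close>. Applied to \<open>Y = V X V X V\<close> this says \<open>X V X \<in> L\<close>, and polarization
  yields (b).

  Suppose that \<open>L\<close> is a subalgebra and \<open>X \<in> L\<close> is invertible. The elements of \<open>L\<close> that commute with
  \<open>X\<close>, in the sense \<open>X V Y = Y V X\<close>, form a finite-dimensional space on which \<open>Y \<mapsto> X V Y\<close> is an
  injective, hence surjective, endomorphism; a preimage of \<open>U\<close> is \<open>U X\<^sup>-\<^sup>1 U\<close>. Thus \<open>L\<close> is stable
  under \<open>X \<mapsto> U X\<^sup>-\<^sup>1 U\<close>, so the inverses of invertible elements of \<open>L\<close> are exactly the invertible
  elements of \<open>V L V\<close>. These are Zariski dense in \<open>V L V\<close>, which is Zariski closed.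

  All limits are taken algebraically: a polynomial function that vanishes at all but finitely
  many points of a line vanishes on the line (\<open>polynomial_vanishes_on_line\<close>).
\<close>

section \<open>Matrices with complex scalars\<close>

lemma cmat_scale_nth [simp]: "cmat_scale c A $ i $ j = c * A $ i $ j"
  by (simp add: cmat_scale_def)

lemma cmat_scale_mult_left: "cmat_scale c A ** B = cmat_scale c (A ** B)"
  by (simp add: vec_eq_iff matrix_matrix_mult_def sum_distrib_left mult_ac)

lemma cmat_scale_mult_right: "A ** cmat_scale c B = cmat_scale c (A ** B)"
  by (simp add: vec_eq_iff matrix_matrix_mult_def sum_distrib_left mult_ac)

lemma cmat_mult_diff_left: "A ** (B - C) = A ** B - A ** (C :: complex ^ 'n ^ 'm)"
  by (simp add: vec_eq_iff matrix_matrix_mult_def sum_subtractf right_diff_distrib)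

lemma cmat_mult_diff_right: "(B - C) ** A = B ** A - (C :: complex ^ 'n ^ 'm) ** A"
  by (simp add: vec_eq_iff matrix_matrix_mult_def sum_subtractf left_diff_distrib)

lemma cmat_mult_add_right: "(B + C) ** A = B ** A + (C :: complex ^ 'n ^ 'm) ** A"
  by (simp add: vec_eq_iff matrix_matrix_mult_def sum.distrib distrib_right)

lemma matrix_inv_mult:
  fixes A :: "complex ^ 'n ^ 'n"
  assumes "det A \<noteq> 0"
  shows "A ** matrix_inv A = mat 1" and "matrix_inv A ** A = mat 1"
proof -
  have "\<exists>B. A ** B = mat 1 \<and> B ** A = mat 1"
    using assms invertible_det_nz[of A] by (simp add: invertible_def)
  from someI_ex[OF this]
  show "A ** matrix_inv A = mat 1" and "matrix_inv A ** A = mat 1"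
    by (simp_all add: matrix_inv_def)
qed

lemma matrix_inv_eqI:
  fixes A B :: "complex ^ 'n ^ 'n"
  assumes "A ** B = mat 1"
  shows "det A \<noteq> 0" and "det B \<noteq> 0" and "matrix_inv A = B"
proof -
  have "det A * det B = 1"
    using assms by (metis det_I det_mul)
  then show A: "det A \<noteq> 0" and "det B \<noteq> 0"
    by auto
  have "matrix_inv A = matrix_inv A ** (A ** B)"
    using assms by simp
  also have "\<dots> = B"
    by (simp add: matrix_mul_assoc matrix_inv_mult[OF A])
  finally show "matrix_inv A = B" .
qed

lemma det_matrix_inv_nonzero:
  fixes A :: "complex ^ 'n ^ 'n"
  assumes "det A \<noteq> 0"
  shows "det (matrix_inv A) \<noteq> 0"
  using matrix_inv_eqI(2)[OF matrix_inv_mult(1)[OF assms]] .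

lemma matrix_inv_involutive:
  fixes A :: "complex ^ 'n ^ 'n"
  assumes "det A \<noteq> 0"
  shows "matrix_inv (matrix_inv A) = A"
  using matrix_inv_eqI(3)[OF matrix_inv_mult(2)[OF assms]] .

lemma transpose_matrix_inv:
  fixes A :: "complex ^ 'n ^ 'n"
  assumes "det A \<noteq> 0" "transpose A = A"
  shows "transpose (matrix_inv A) = matrix_inv A"
proof -
  have "A ** transpose (matrix_inv A) = transpose (matrix_inv A ** A)"
    by (simp add: matrix_transpose_mul assms(2))
  also have "\<dots> = mat 1"
    by (simp add: matrix_inv_mult[OF assms(1)] transpose_mat)
  finally show ?thesis
    using matrix_inv_eqI(3) by metis
qed

lemma congruence_cancel:
  fixes A B X :: "complex ^ 'n ^ 'n"
  assumes "A ** B = mat 1" "B ** A = mat 1"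
  shows "A ** (B ** X ** B) ** A = X"
proof -
  have "A ** (B ** X ** B) ** A = (A ** B) ** X ** (B ** A)"
    by (simp only: matrix_mul_assoc)
  then show ?thesis
    by (simp add: assms)
qed

lemma congruence_linear_subspace:
  assumes L: "linear_subspace_of_symmetric L" and A: "transpose A = A"
  shows "linear_subspace_of_symmetric ((\<lambda>X. A ** X ** A) ` L)" (is "linear_subspace_of_symmetric ?I")
proof -
  from L have sub: "cmat_subspace L" and sym: "\<And>X. X \<in> L \<Longrightarrow> transpose X = X"
    by (auto simp: linear_subspace_of_symmetric_def symmetric_matrices_def)
  have "A ** 0 ** A = 0"
    by (simp add: vec_eq_iff matrix_matrix_mult_def)
  then have "0 \<in> ?I"
    using cmat.subspace_0[OF sub] by (metis imageI)
  moreover have "A ** X ** A + A ** Y ** A \<in> ?I" if "X \<in> L" "Y \<in> L" for X Y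
    using imageI[OF cmat.subspace_add[OF sub that], of "\<lambda>X. A ** X ** A"]
    by (simp add: matrix_add_ldistrib cmat_mult_add_right)
  moreover have "cmat_scale c (A ** X ** A) \<in> ?I" if "X \<in> L" for c X
    using imageI[OF cmat.subspace_scale[OF sub that], of "\<lambda>X. A ** X ** A" c]
    by (simp add: cmat_scale_mult_left cmat_scale_mult_right)
  ultimately have "cmat_subspace ?I"
    unfolding cmat.subspace_def by auto
  moreover have "?I \<subseteq> symmetric_matrices"
    using A sym by (auto simp: symmetric_matrices_def matrix_transpose_mul matrix_mul_assoc)
  ultimately show ?thesis
    by (simp add: linear_subspace_of_symmetric_def)
qed

section \<open>Polynomial functions and Zariski closed sets\<close>

lemma matrix_polynomial_function_sum:
  assumes "\<And>i. i \<in> I \<Longrightarrow> matrix_polynomial_function (f i)"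
  shows "matrix_polynomial_function (\<lambda>X. \<Sum>i\<in>I. f i X)"
  using assms
  by (induction I rule: infinite_finite_induct)
     (auto intro: matrix_polynomial_function.intros)

lemma matrix_polynomial_function_prod:
  assumes "\<And>i. i \<in> I \<Longrightarrow> matrix_polynomial_function (f i)"
  shows "matrix_polynomial_function (\<lambda>X. \<Prod>i\<in>I. f i X)"
  using assms
  by (induction I rule: infinite_finite_induct)
     (auto intro: matrix_polynomial_function.intros)

lemma matrix_polynomial_function_diff:
  assumes "matrix_polynomial_function f" "matrix_polynomial_function g"
  shows "matrix_polynomial_function (\<lambda>X. f X - g X)"
proof -
  have "matrix_polynomial_function (\<lambda>X. f X + (- 1) * g X)"
    by (intro matrix_polynomial_function.intros assms)
  then show ?thesis
    by simp
qed

definition matrix_polynomial_map :: "(complex ^ 'n ^ 'n \<Rightarrow> complex ^ 'n ^ 'n) \<Rightarrow> bool" where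
  "matrix_polynomial_map \<phi> \<longleftrightarrow> (\<forall>i j. matrix_polynomial_function (\<lambda>X. \<phi> X $ i $ j))"

lemma matrix_polynomial_function_compose:
  assumes "matrix_polynomial_function f" and "matrix_polynomial_map \<phi>"
  shows "matrix_polynomial_function (\<lambda>X. f (\<phi> X))"
  using assms(1)
proof induction
  case (entry i j)
  then show ?case
    using assms(2) by (simp add: matrix_polynomial_map_def)
qed (auto intro: matrix_polynomial_function.intros)

lemma matrix_polynomial_map_id: "matrix_polynomial_map (\<lambda>X. X)"
  by (simp add: matrix_polynomial_map_def matrix_polynomial_function.entry)

lemma matrix_polynomial_map_const: "matrix_polynomial_map (\<lambda>X. A)"
  by (simp add: matrix_polynomial_map_def matrix_polynomial_function.const)

lemma matrix_polynomial_map_mult: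
  assumes "matrix_polynomial_map \<phi>" "matrix_polynomial_map \<psi>"
  shows "matrix_polynomial_map (\<lambda>X. \<phi> X ** \<psi> X)"
  using assms unfolding matrix_polynomial_map_def matrix_matrix_mult_def
  by (auto intro!: matrix_polynomial_function_sum matrix_polynomial_function.mult)

lemma matrix_polynomial_function_det:
  assumes "matrix_polynomial_map \<phi>"
  shows "matrix_polynomial_function (\<lambda>X. det (\<phi> X))"
  using assms unfolding det_def matrix_polynomial_map_def
  by (intro matrix_polynomial_function_sum matrix_polynomial_function.mult
      matrix_polynomial_function_prod matrix_polynomial_function.const) auto

text \<open>The Zariski topology is defined relative to the symmetric matrices; symmetry is itself a
  system of polynomial equations.\<close>

lemma zariski_closed_vanishing_set:
  assumes "zariski_closed Z"
  shows "\<exists>F. (\<forall>f\<in>F. matrix_polynomial_function f) \<and> Z = {X. \<forall>f\<in>F. f X = 0}"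
proof -
  obtain F where F: "\<forall>f\<in>F. matrix_polynomial_function f"
    and Z: "Z = {X \<in> symmetric_matrices. \<forall>f\<in>F. f X = 0}"
    using assms unfolding zariski_closed_def by (elim exE conjE)
  let ?G = "range (\<lambda>(i, j) X. X $ i $ j - X $ j $ i)"
  have "\<forall>f\<in>F \<union> ?G. matrix_polynomial_function f"
    using F by (auto intro!: matrix_polynomial_function_diff matrix_polynomial_function.entry)
  moreover have "symmetric_matrices = {X. \<forall>f\<in>?G. f X = 0}"
    by (auto simp: symmetric_matrices_def vec_eq_iff transpose_def)
  then have "Z = {X. \<forall>f\<in>F \<union> ?G. f X = 0}"
    unfolding Z by blast
  ultimately show ?thesis
    by blast
qed

lemma zariski_closed_preimage:
  assumes "zariski_closed Z" and \<phi>: "matrix_polynomial_map \<phi>"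
  shows "zariski_closed {X \<in> symmetric_matrices. \<phi> X \<in> Z}"
proof -
  obtain F where F: "\<forall>f\<in>F. matrix_polynomial_function f"
    and Z: "Z = {X. \<forall>f\<in>F. f X = 0}"
    using zariski_closed_vanishing_set[OF assms(1)] by blast
  show ?thesis
    unfolding zariski_closed_def Z
    using F by (intro exI[of _ "(\<lambda>f X. f (\<phi> X)) ` F"])
      (auto intro: matrix_polynomial_function_compose[OF _ \<phi>])
qed

text \<open>A linear subspace is the fixed point set of a projection onto it, and the coordinates of a
  linear map are polynomial functions.\<close>

lemma linear_subspace_zariski_closed:
  fixes S :: "(complex ^ 'n ^ 'n) set"
  assumes "linear_subspace_of_symmetric S"
  shows "zariski_closed S"
proof -
  interpret P: vector_space_pair "cmat_scale :: complex \<Rightarrow> complex ^ 'n ^ 'n \<Rightarrow> _"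
      "cmat_scale :: complex \<Rightarrow> complex ^ 'n ^ 'n \<Rightarrow> _"
    by unfold_locales
  from assms have sub: "cmat_subspace S" and sym: "S \<subseteq> symmetric_matrices"
    by (auto simp: linear_subspace_of_symmetric_def)
  have "Vector_Spaces.linear cmat_scale cmat_scale (\<lambda>X :: complex ^ 'n ^ 'n. X)"
    by unfold_locales auto
  then obtain g where g: "g ` UNIV \<subseteq> S" "Vector_Spaces.linear cmat_scale cmat_scale g"
      "\<forall>v\<in>S. g v = v"
    using P.linear_exists_left_inverse_on[of "\<lambda>X. X" S] sub by (auto simp: inj_on_def cmat_subspace_def)
  interpret g: Vector_Spaces.linear cmat_scale cmat_scale g
    by (fact g(2))
  have S: "S = {X \<in> symmetric_matrices. g X - X = 0}"
    using g(1,3) sym by (auto, metis rangeI subsetD)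
  let ?E = "\<lambda>i j. (\<chi> k l. if k = i \<and> l = j then 1 else 0) :: complex ^ 'n ^ 'n"
  have expand: "X = (\<Sum>i\<in>UNIV. \<Sum>j\<in>UNIV. cmat_scale (X $ i $ j) (?E i j))" for X :: "complex ^ 'n ^ 'n"
  proof -
    have "(\<Sum>i\<in>UNIV. \<Sum>j\<in>UNIV. X $ i $ j * (if k = i \<and> l = j then 1 else 0)) = X $ k $ l" for k l
    proof -
      have "(\<Sum>i\<in>UNIV. \<Sum>j\<in>UNIV. X $ i $ j * (if k = i \<and> l = j then 1 else 0))
          = (\<Sum>i\<in>UNIV. if k = i then X $ i $ l else 0)"
        by (intro sum.cong refl) (auto simp: if_distrib cong: if_cong)
      then show ?thesis
        by simp
    qed
    then show ?thesis
      by (simp add: vec_eq_iff)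
  qed
  have g_eq: "g X = (\<Sum>i\<in>UNIV. \<Sum>j\<in>UNIV. cmat_scale (X $ i $ j) (g (?E i j)))" for X
    by (subst expand[of X]) (simp only: g.sum g.scale)
  have "g X $ k $ l = (\<Sum>i\<in>UNIV. \<Sum>j\<in>UNIV. X $ i $ j * g (?E i j) $ k $ l)" for X k l
    by (subst g_eq) (simp only: sum_component cmat_scale_nth)
  then have coord: "(\<lambda>X. g X $ k $ l)
      = (\<lambda>X. \<Sum>i\<in>UNIV. \<Sum>j\<in>UNIV. X $ i $ j * g (?E i j) $ k $ l)" for k l
    by (rule ext)
  have "matrix_polynomial_function (\<lambda>X. g X $ k $ l)" for k l
    by (subst coord) (intro matrix_polynomial_function_sum matrix_polynomial_function.mult
        matrix_polynomial_function.entry matrix_polynomial_function.const)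
  then have pol: "matrix_polynomial_function (\<lambda>X. (g X - X) $ i $ j)" for i j
    by (simp add: matrix_polynomial_function_diff matrix_polynomial_function.entry)
  have "S = {X \<in> symmetric_matrices. \<forall>f\<in>range (\<lambda>(i, j) X. (g X - X) $ i $ j). f X = 0}"
    by (subst S) (auto simp: vec_eq_iff)
  moreover have "\<forall>f\<in>range (\<lambda>(i, j) X. (g X - X) $ i $ j). matrix_polynomial_function f"
    using pol by auto
  ultimately show ?thesis
    unfolding zariski_closed_def by blast
qed

section \<open>Specialization along lines\<close>

lemma matrix_polynomial_function_on_line:
  assumes "matrix_polynomial_function f"
  shows "\<exists>p. \<forall>t. f (A + cmat_scale t B) = poly p t"
  using assms
proof induction
  case (const c)
  show ?case
    by (intro exI[of _ "[:c:]"]) simp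
next
  case (entry i j)
  show ?case
    by (intro exI[of _ "[:A $ i $ j, B $ i $ j:]"]) simp
next
  case (add f g)
  then obtain p q where "\<forall>t. f (A + cmat_scale t B) = poly p t" "\<forall>t. g (A + cmat_scale t B) = poly q t"
    by blast
  then show ?case
    by (intro exI[of _ "p + q"]) simp
next
  case (mult f g)
  then obtain p q where "\<forall>t. f (A + cmat_scale t B) = poly p t" "\<forall>t. g (A + cmat_scale t B) = poly q t"
    by blast
  then show ?case
    by (intro exI[of _ "p * q"]) simp
qed

text \<open>This replaces the passage to the limit \<open>t \<rightarrow> 0\<close>: the product \<open>t q f\<close>, restricted to the line,
  is the zero polynomial, and the factors \<open>t\<close> and \<open>q\<close> are not.\<close>

lemma polynomial_vanishes_on_line:
  assumes f: "matrix_polynomial_function f" and q: "matrix_polynomial_function q"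
    and nz: "q (A + cmat_scale s B) \<noteq> 0"
    and van: "\<And>t. t \<noteq> 0 \<Longrightarrow> q (A + cmat_scale t B) \<noteq> 0 \<Longrightarrow> f (A + cmat_scale t B) = 0"
  shows "f A = 0"
proof -
  obtain p where p: "\<forall>t. f (A + cmat_scale t B) = poly p t"
    using matrix_polynomial_function_on_line[OF f] by blast
  obtain r where r: "\<forall>t. q (A + cmat_scale t B) = poly r t"
    using matrix_polynomial_function_on_line[OF q] by blast
  have "poly ([:0, 1:] * r * p) t = 0" for t
    using van[of t] p r by auto
  then have "[:0, 1:] * r * p = 0"
    using poly_all_0_iff_0 by blast
  moreover have "r \<noteq> 0"
    using nz r by auto
  ultimately have "p = 0"
    by simp
  with p have "f (A + cmat_scale 0 B) = 0"
    by (metis poly_0)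
  moreover have "A + cmat_scale 0 B = A"
    by (simp add: vec_eq_iff)
  ultimately show ?thesis
    by simp
qed

corollary zariski_closed_on_line:
  assumes "zariski_closed Z" and \<phi>: "matrix_polynomial_map \<phi>"
    and q: "matrix_polynomial_function q" and nz: "q (A + cmat_scale s B) \<noteq> 0"
    and mem: "\<And>t. t \<noteq> 0 \<Longrightarrow> q (A + cmat_scale t B) \<noteq> 0 \<Longrightarrow> \<phi> (A + cmat_scale t B) \<in> Z"
  shows "\<phi> A \<in> Z"
proof -
  obtain F where F: "\<forall>f\<in>F. matrix_polynomial_function f"
    and Z: "Z = {X. \<forall>f\<in>F. f X = 0}"
    using zariski_closed_vanishing_set[OF assms(1)] by blast
  have "f (\<phi> A) = 0" if "f \<in> F" for f
    using polynomial_vanishes_on_line[OF matrix_polynomial_function_compose[OF _ \<phi>] q nz, of f]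
      mem that F Z by blast
  then show ?thesis
    using Z by simp
qed

section \<open>The adjugate and the reciprocal variety\<close>

text \<open>The \<open>j\<close>-th column of \<open>A\<^sup>-\<^sup>1\<close> solves \<open>A x = e\<^sub>j\<close>; its entries are given by Cramer's rule, and
  the adjugate collects the numerators.\<close>

definition adjugate :: "complex ^ 'n ^ 'n \<Rightarrow> complex ^ 'n ^ 'n" where
  "adjugate A = (\<chi> k j. det (\<chi> i l. if l = k then axis j 1 $ i else A $ i $ l))"

lemma matrix_polynomial_map_adjugate: "matrix_polynomial_map adjugate"
  unfolding matrix_polynomial_map_def adjugate_def
proof (simp, intro allI matrix_polynomial_function_det)
  fix k j :: "'n::finite"
  show "matrix_polynomial_map (\<lambda>X. \<chi> i l. if l = k then axis j 1 $ i else X $ i $ l)"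
    unfolding matrix_polynomial_map_def
  proof (intro allI)
    fix i l :: 'n
    show "matrix_polynomial_function
        (\<lambda>X. (\<chi> i l. if l = k then axis j 1 $ i else X $ i $ l) $ i $ l)"
      by (cases "l = k") (auto intro: matrix_polynomial_function.intros)
  qed
qed

lemma adjugate_eq:
  fixes A :: "complex ^ 'n ^ 'n"
  assumes "det A \<noteq> 0"
  shows "adjugate A = cmat_scale (det A) (matrix_inv A)"
proof -
  have "adjugate A $ k $ j = det A * matrix_inv A $ k $ j" for k j
  proof -
    have "A *v (matrix_inv A *v axis j 1) = axis j 1"
      by (simp add: matrix_vector_mul_assoc matrix_inv_mult[OF assms])
    then have "matrix_inv A *v axis j 1 =
        (\<chi> k. det (\<chi> i l. if l = k then axis j 1 $ i else A $ i $ l) / det A)"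
      using cramer[OF assms] by blast
    then have "(matrix_inv A *v axis j 1) $ k = adjugate A $ k $ j / det A"
      by (simp add: adjugate_def)
    then show ?thesis
      using assms by (simp add: matrix_vector_mult_def axis_def if_distrib cong: if_cong)
  qed
  then show ?thesis
    by (simp add: vec_eq_iff)
qed

lemma reciprocal_subset_variety:
  assumes "X \<in> invertible_part L"
  shows "matrix_inv X \<in> reciprocal_variety L"
  using assms hull_subset[of "matrix_inv ` invertible_part L" zariski_closed]
  unfolding reciprocal_variety_def zariski_closure_def by blast

lemma reciprocals_symmetric:
  assumes "L \<subseteq> symmetric_matrices"
  shows "matrix_inv ` invertible_part L \<subseteq> symmetric_matrices"
  using assms transpose_matrix_inv by (auto simp: symmetric_matrices_def invertible_part_def)

lemma reciprocal_variety_minimal: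
  assumes "zariski_closed Z" and "\<And>X. X \<in> invertible_part L \<Longrightarrow> matrix_inv X \<in> Z"
  shows "reciprocal_variety L \<subseteq> Z"
  unfolding reciprocal_variety_def zariski_closure_def
  using assms by (intro hull_minimal) auto

text \<open>Membership of the adjugate in \<open>L\<close> is a polynomial condition, and it holds for the inverses of
  elements of \<open>L\<close>; so it holds on their closure.\<close>

lemma adjugate_of_reciprocal_variety:
  assumes L: "linear_subspace_of_symmetric L" and Y: "Y \<in> reciprocal_variety L"
  shows "adjugate Y \<in> L"
proof -
  from L have sub: "cmat_subspace L" and sym: "L \<subseteq> symmetric_matrices"
    by (auto simp: linear_subspace_of_symmetric_def)
  have "reciprocal_variety L \<subseteq> {Y \<in> symmetric_matrices. adjugate Y \<in> L}"
  proof (rule reciprocal_variety_minimal)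
    show "zariski_closed {Y \<in> symmetric_matrices. adjugate Y \<in> L}"
      by (intro zariski_closed_preimage linear_subspace_zariski_closed L
          matrix_polynomial_map_adjugate)
  next
    fix X assume X: "X \<in> invertible_part L"
    then have d: "det X \<noteq> 0" and "X \<in> L"
      by (auto simp: invertible_part_def)
    then have "adjugate (matrix_inv X) \<in> L"
      by (simp add: adjugate_eq det_matrix_inv_nonzero matrix_inv_involutive
          cmat.subspace_scale[OF sub])
    then show "matrix_inv X \<in> {Y \<in> symmetric_matrices. adjugate Y \<in> L}"
      using reciprocals_symmetric[OF sym] X by blast
  qed
  with Y show ?thesis
    by blast
qed

lemma matrix_inv_of_reciprocal_variety:
  assumes L: "linear_subspace_of_symmetric L" and "Y \<in> invertible_part (reciprocal_variety L)"
  shows "matrix_inv Y \<in> L"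
proof -
  from assms(2) have d: "det Y \<noteq> 0" and "adjugate Y \<in> L"
    using adjugate_of_reciprocal_variety[OF L] by (auto simp: invertible_part_def)
  moreover have "cmat_subspace L"
    using L by (simp add: linear_subspace_of_symmetric_def)
  ultimately have "cmat_scale (1 / det Y) (adjugate Y) \<in> L"
    using cmat.subspace_scale by blast
  then show ?thesis
    using d by (simp add: adjugate_eq)
qed

section \<open>A linear reciprocal variety\<close>

text \<open>With \<open>B = A\<^sup>-\<^sup>1\<close> and \<open>R\<close> the inverse of \<open>A + t Y\<close>, the resolvent identities
  \<open>B - R = t B Y R\<close> and \<open>B Y B - B Y R = t B Y B Y R\<close> put these difference quotients into \<open>T\<close>
  for \<open>t \<noteq> 0\<close>. Multiplication by \<open>det (A + t Y)\<close> turns \<open>R\<close> into the adjugate, which is polynomial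
  in \<open>t\<close>, so that \<open>t = 0\<close> is covered as well.\<close>

lemma resolvent_terms_in_subspace:
  fixes S T :: "(complex ^ 'n ^ 'n) set"
  assumes S: "cmat_subspace S" and T: "linear_subspace_of_symmetric T"
    and inv: "\<And>X. X \<in> invertible_part S \<Longrightarrow> matrix_inv X \<in> T"
    and A: "A \<in> invertible_part S" and Y: "Y \<in> S"
  defines "B \<equiv> matrix_inv A"
  shows "B ** Y ** B \<in> T" and "B ** Y ** B ** Y ** B \<in> T"
proof -
  have T': "cmat_subspace T"
    using T by (simp add: linear_subspace_of_symmetric_def)
  have A': "A \<in> S" and dA: "det A \<noteq> 0"
    using A by (auto simp: invertible_part_def)
  have BA: "B ** A = mat 1"
    using matrix_inv_mult[OF dA] by (simp add: B_def)
  have limit: "C ** B \<in> T"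
    if C: "\<And>t. t \<noteq> 0 \<Longrightarrow> det (A + cmat_scale t Y) \<noteq> 0 \<Longrightarrow>
      C ** matrix_inv (A + cmat_scale t Y) \<in> T" for C
  proof -
    have "C ** adjugate A \<in> T"
    proof (rule zariski_closed_on_line[where \<phi> = "\<lambda>Z. C ** adjugate Z" and q = det and s = 0])
      show "zariski_closed T"
        by (rule linear_subspace_zariski_closed[OF T])
      show "matrix_polynomial_map (\<lambda>Z. C ** adjugate Z)"
        by (intro matrix_polynomial_map_mult matrix_polynomial_map_const
            matrix_polynomial_map_adjugate)
      show "matrix_polynomial_function (det :: complex ^ 'n ^ 'n \<Rightarrow> complex)"
        by (rule matrix_polynomial_function_det[OF matrix_polynomial_map_id])
      show "det (A + cmat_scale 0 Y) \<noteq> 0"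
        using dA by simp
      fix t assume "t \<noteq> 0" "det (A + cmat_scale t Y) \<noteq> 0"
      with C show "C ** adjugate (A + cmat_scale t Y) \<in> T"
        by (simp add: adjugate_eq cmat_scale_mult_right cmat.subspace_scale[OF T'])
    qed
    then have "cmat_scale (1 / det A) (C ** adjugate A) \<in> T"
      by (rule cmat.subspace_scale[OF T'])
    then show ?thesis
      using dA by (simp add: adjugate_eq cmat_scale_mult_right B_def)
  qed
  \<comment> \<open>both resolvent identities are one identity multiplied by \<open>C\<close> from the left: \<open>C = 1\<close> gives the
    first, \<open>C = B Y\<close> the second\<close>
  have quotient: "C ** B ** Y ** matrix_inv (A + cmat_scale t Y) \<in> T"
    if "t \<noteq> 0" and d: "det (A + cmat_scale t Y) \<noteq> 0"
      and "C ** B \<in> T" and "C ** matrix_inv (A + cmat_scale t Y) \<in> T" for C t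
  proof -
    let ?R = "matrix_inv (A + cmat_scale t Y)"
    have "B ** cmat_scale t Y ** ?R = B ** ((A + cmat_scale t Y) - A) ** ?R"
      by simp
    also have "\<dots> = B ** ((A + cmat_scale t Y) ** ?R) - (B ** A) ** ?R"
      by (simp only: cmat_mult_diff_left cmat_mult_diff_right matrix_mul_assoc)
    also have "\<dots> = B - ?R"
      by (simp add: BA matrix_inv_mult[OF d])
    finally have "C ** (B ** cmat_scale t Y ** ?R) = C ** B - C ** ?R"
      by (simp add: cmat_mult_diff_left)
    then have "cmat_scale t (C ** B ** Y ** ?R) = C ** B - C ** ?R"
      by (simp add: cmat_scale_mult_left cmat_scale_mult_right matrix_mul_assoc)
    then have "cmat_scale t (C ** B ** Y ** ?R) \<in> T"
      using that cmat.subspace_diff[OF T'] by simp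
    from cmat.subspace_scale[OF T' this, of "1 / t"] show ?thesis
      using \<open>t \<noteq> 0\<close> by simp
  qed
  have R: "matrix_inv (A + cmat_scale t Y) \<in> T" if "det (A + cmat_scale t Y) \<noteq> 0" for t
    using that inv cmat.subspace_add[OF S A'] cmat.subspace_scale[OF S Y]
    by (simp add: invertible_part_def)
  have BT: "B \<in> T"
    using inv[OF A] by (simp add: B_def)
  have first: "B ** Y ** matrix_inv (A + cmat_scale t Y) \<in> T"
    if "t \<noteq> 0" "det (A + cmat_scale t Y) \<noteq> 0" for t
    using quotient[OF that, of "mat 1"] BT R that by simp
  then show BYB: "B ** Y ** B \<in> T"
    using limit by blast
  have "B ** Y ** B ** Y ** matrix_inv (A + cmat_scale t Y) \<in> T"
    if "t \<noteq> 0" "det (A + cmat_scale t Y) \<noteq> 0" for t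
    using quotient[OF that, of "B ** Y"] BYB first[OF that] by simp
  then show "B ** Y ** B ** Y ** B \<in> T"
    using limit by blast
qed

text \<open>Squares suffice for the Jordan product, by polarization.\<close>

lemma jordan_subalgebraI:
  assumes L: "linear_subspace_of_symmetric L"
    and sq: "\<And>X. X \<in> L \<Longrightarrow> X ** matrix_inv U ** X \<in> L"
  shows "jordan_subalgebra U L"
proof -
  have sub: "cmat_subspace L"
    using L by (simp add: linear_subspace_of_symmetric_def)
  have "jordan_product U X Y \<in> L" if X: "X \<in> L" and Y: "Y \<in> L" for X Y
  proof -
    let ?V = "matrix_inv U"
    have "X ** ?V ** Y + Y ** ?V ** X = (X + Y) ** ?V ** (X + Y) - X ** ?V ** X - Y ** ?V ** Y"
      by (simp add: matrix_add_ldistrib cmat_mult_add_right)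
    also have "\<dots> \<in> L"
      using sq[OF X] sq[OF Y] sq[OF cmat.subspace_add[OF sub X Y]]
      by (intro cmat.subspace_diff[OF sub])
    finally show ?thesis
      unfolding jordan_product_def by (rule cmat.subspace_scale[OF sub])
  qed
  with L show ?thesis
    by (simp add: jordan_subalgebra_def)
qed

lemma jordan_subalgebra_if_reciprocal_linear:
  assumes L: "linear_subspace_of_symmetric L" and U: "U \<in> invertible_part L"
    and M: "linear_subspace_of_symmetric (reciprocal_variety L)"
  shows "jordan_subalgebra U L"
proof (rule jordan_subalgebraI[OF L])
  fix X assume X: "X \<in> L"
  let ?M = "reciprocal_variety L" and ?V = "matrix_inv U"
  have d: "det U \<noteq> 0"
    using U by (simp add: invertible_part_def)
  note [simp] = matrix_inv_mult[OF d]
  have V: "?V \<in> invertible_part ?M"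
    using reciprocal_subset_variety[OF U] det_matrix_inv_nonzero[OF d]
    by (simp add: invertible_part_def)
  have "?V ** X ** ?V ** X ** ?V \<in> ?M"
    using L M U X reciprocal_subset_variety
    by (intro resolvent_terms_in_subspace(2)) (auto simp: linear_subspace_of_symmetric_def)
  then have "matrix_inv ?V ** (?V ** X ** ?V ** X ** ?V) ** matrix_inv ?V \<in> L"
    using L M V matrix_inv_of_reciprocal_variety[OF L]
    by (intro resolvent_terms_in_subspace(1)) (auto simp: linear_subspace_of_symmetric_def)
  moreover have "U ** (?V ** (X ** ?V ** X) ** ?V) ** U = X ** ?V ** X"
    by (rule congruence_cancel) simp_all
  ultimately show "X ** ?V ** X \<in> L"
    by (simp add: matrix_inv_involutive[OF d] matrix_mul_assoc)
qed

section \<open>Inverses in a Jordan subalgebra\<close>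

text \<open>An invertible element \<open>X\<close> of a finite-dimensional algebra with unit has its inverse there.
  Because multiplication by \<open>X\<close> on the Jordan algebra need not be injective, it is restricted to the
  elements that operator-commute with \<open>X\<close>, where it becomes \<open>Y \<mapsto> X U\<^sup>-\<^sup>1 Y\<close>.\<close>

lemma jordan_subalgebra_inverse:
  fixes L :: "(complex ^ 'n ^ 'n) set"
  assumes J: "jordan_subalgebra U L" and U: "U \<in> invertible_part L" and X: "X \<in> invertible_part L"
  shows "U ** matrix_inv X ** U \<in> L"
proof -
  let ?V = "matrix_inv U"
  have dU: "det U \<noteq> 0" and UL: "U \<in> L" and dX: "det X \<noteq> 0" and XL: "X \<in> L"
    using U X by (auto simp: invertible_part_def)
  note inv [simp] = matrix_inv_mult[OF dU] matrix_inv_mult[OF dX]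
  have sub: "cmat_subspace L" and prod: "\<And>Y. Y \<in> L \<Longrightarrow> jordan_product U X Y \<in> L"
    using J XL by (auto simp: jordan_subalgebra_def linear_subspace_of_symmetric_def)
  define f where "f Y = X ** ?V ** Y" for Y :: "complex ^ 'n ^ 'n"
  define W where "W = {Y \<in> L. X ** ?V ** Y = Y ** ?V ** X}"
  have scaleR_eq: "r *\<^sub>R Y = cmat_scale (of_real r) Y" for r and Y :: "complex ^ 'n ^ 'n"
    unfolding vec_eq_iff cmat_scale_nth vector_scaleR_component by (simp add: scaleR_conv_of_real)
  have lin: "linear f"
    unfolding f_def
    by (intro linearI) (simp_all add: matrix_add_ldistrib scaleR_eq cmat_scale_mult_right)
  have subW: "subspace W"
    unfolding subspace_def W_def
    by (auto simp: scaleR_eq cmat.subspace_0[OF sub] cmat.subspace_add[OF sub]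
        cmat.subspace_scale[OF sub] matrix_add_ldistrib cmat_mult_add_right
        cmat_scale_mult_left cmat_scale_mult_right)
  have cancel: "U ** matrix_inv X ** f Y = Y" for Y
  proof -
    have "U ** matrix_inv X ** f Y = U ** (matrix_inv X ** X) ** ?V ** Y"
      by (simp only: f_def matrix_mul_assoc)
    then show ?thesis
      by simp
  qed
  have inj: "inj f"
    by (metis cancel injI)
  have "f Y \<in> W" if "Y \<in> W" for Y
  proof -
    from that have YL: "Y \<in> L" and comm: "X ** ?V ** Y = Y ** ?V ** X"
      by (auto simp: W_def)
    have "jordan_product U X Y = cmat_scale (1 / 2) (f Y + f Y)"
      by (simp add: jordan_product_def f_def comm)
    also have "\<dots> = f Y"
      by (simp add: vec_eq_iff)
    finally have "f Y \<in> L"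
      using prod[OF YL] by simp
    moreover have "X ** ?V ** f Y = f Y ** ?V ** X"
      by (simp add: f_def comm matrix_mul_assoc[of "X ** ?V"])
    ultimately show ?thesis
      by (simp add: W_def)
  qed
  then have "f ` W \<subseteq> W"
    by blast
  moreover have "dim (f ` W) = dim W"
    by (rule dim_image_eq[OF lin]) (use inj in \<open>auto simp: inj_on_def\<close>)
  ultimately have "f ` W = W"
    using subspace_dim_equal[OF linear_subspace_image[OF lin subW] subW] by simp
  moreover have "U \<in> W"
  proof -
    have "X ** ?V ** U = U ** ?V ** X"
      by (simp add: matrix_mul_assoc[symmetric])
    with UL show ?thesis
      by (simp add: W_def)
  qed
  ultimately obtain Y where "Y \<in> W" "f Y = U"
    by (metis imageE)
  then show ?thesis
    using cancel[of Y] by (simp add: W_def)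
qed

lemma reciprocal_variety_of_jordan_subalgebra:
  fixes L :: "(complex ^ 'n ^ 'n) set"
  assumes J: "jordan_subalgebra U L" and U: "U \<in> invertible_part L"
  shows "reciprocal_variety L = (\<lambda>X. matrix_inv U ** X ** matrix_inv U) ` L"
proof
  let ?V = "matrix_inv U"
  have L: "linear_subspace_of_symmetric L"
    using J by (simp add: jordan_subalgebra_def)
  then have sub: "cmat_subspace L" and sym: "L \<subseteq> symmetric_matrices"
    by (auto simp: linear_subspace_of_symmetric_def)
  have dU: "det U \<noteq> 0" and UL: "U \<in> L"
    using U by (auto simp: invertible_part_def)
  note inv [simp] = matrix_inv_mult[OF dU]
  have VV: "transpose ?V = ?V"
    using transpose_matrix_inv[OF dU] UL sym by (auto simp: symmetric_matrices_def)
  show "reciprocal_variety L \<subseteq> (\<lambda>X. ?V ** X ** ?V) ` L"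
  proof (rule reciprocal_variety_minimal)
    show "zariski_closed ((\<lambda>X. ?V ** X ** ?V) ` L)"
      by (intro linear_subspace_zariski_closed congruence_linear_subspace L VV)
    fix X assume "X \<in> invertible_part L"
    moreover have "?V ** (U ** matrix_inv X ** U) ** ?V = matrix_inv X"
      by (rule congruence_cancel) simp_all
    ultimately show "matrix_inv X \<in> (\<lambda>X. ?V ** X ** ?V) ` L"
      using jordan_subalgebra_inverse[OF J U] by (metis imageI)
  qed
  have invertible: "?V ** Y ** ?V \<in> reciprocal_variety L" if Y: "Y \<in> invertible_part L" for Y
  proof -
    have dY: "det Y \<noteq> 0"
      using Y by (simp add: invertible_part_def)
    let ?Z = "U ** matrix_inv Y ** U"
    have "?Z ** (?V ** Y ** ?V) = U ** (matrix_inv Y ** ((U ** ?V) ** Y)) ** ?V"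
      by (simp only: matrix_mul_assoc)
    then have "?Z ** (?V ** Y ** ?V) = mat 1"
      by (simp add: matrix_inv_mult[OF dY])
    then have "det ?Z \<noteq> 0" "matrix_inv ?Z = ?V ** Y ** ?V"
      using matrix_inv_eqI by blast+
    with jordan_subalgebra_inverse[OF J U Y] show ?thesis
      using reciprocal_subset_variety[of ?Z L] by (simp add: invertible_part_def)
  qed
  show "(\<lambda>X. ?V ** X ** ?V) ` L \<subseteq> reciprocal_variety L"
  proof (rule image_subsetI)
    fix X assume X: "X \<in> L"
    \<comment> \<open>the line through \<open>X\<close> and \<open>U\<close> leaves the hypersurface \<open>det = 0\<close> at the parameter \<open>1\<close>\<close>
    show "?V ** X ** ?V \<in> reciprocal_variety L"
    proof (rule zariski_closed_on_line[where \<phi> = "\<lambda>X. ?V ** X ** ?V" and q = det and s = 1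
          and B = "U - X"])
      show "zariski_closed (reciprocal_variety L)"
        unfolding reciprocal_variety_def
        by (intro zariski_closed_closure reciprocals_symmetric sym)
      show "matrix_polynomial_map (\<lambda>X. ?V ** X ** ?V)"
        by (intro matrix_polynomial_map_mult matrix_polynomial_map_const matrix_polynomial_map_id)
      show "matrix_polynomial_function (det :: complex ^ 'n ^ 'n \<Rightarrow> complex)"
        by (rule matrix_polynomial_function_det[OF matrix_polynomial_map_id])
      show "det (X + cmat_scale 1 (U - X)) \<noteq> 0"
        using dU by simp
      fix t assume "det (X + cmat_scale t (U - X)) \<noteq> 0"
      moreover have "X + cmat_scale t (U - X) \<in> L"
        using X UL by (intro cmat.subspace_add[OF sub] cmat.subspace_scale[OF sub]
            cmat.subspace_diff[OF sub])
      ultimately show "?V ** (X + cmat_scale t (U - X)) ** ?V \<in> reciprocal_variety L"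
        by (intro invertible) (simp add: invertible_part_def)
    qed
  qed
qed

section \<open>The equivalence\<close>

theorem theorem1p1:
  fixes L :: "(complex ^ 'n ^ 'n) set" and U :: "complex ^ 'n ^ 'n" and m :: nat
  assumes "linear_subspace_of_symmetric L"
    and "cmat_dim L = m"
    and "invertible_part L \<noteq> {}"
    and "U \<in> invertible_part L"
  shows "(linear_subspace_of_symmetric (reciprocal_variety L) \<longleftrightarrow> jordan_subalgebra U L) \<and>
    (jordan_subalgebra U L \<longleftrightarrow>
      reciprocal_variety L = (\<lambda>X. matrix_inv U ** X ** matrix_inv U) ` L)"
proof -
  note L = assms(1) and U = assms(4)
  have "transpose (matrix_inv U) = matrix_inv U"
    using L U by (intro transpose_matrix_inv)
      (auto simp: linear_subspace_of_symmetric_def symmetric_matrices_def invertible_part_def)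
  then have "linear_subspace_of_symmetric (reciprocal_variety L)"
    if "reciprocal_variety L = (\<lambda>X. matrix_inv U ** X ** matrix_inv U) ` L"
    using congruence_linear_subspace[OF L] that by simp
  then show ?thesis
    using jordan_subalgebra_if_reciprocal_linear[OF L U]
      reciprocal_variety_of_jordan_subalgebra[OF _ U] by blast
qed

end
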